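(* Let $(\mathcal G_1,e_1)$ and $(\mathcal G_2,e_2)$ be rooted graphs, and let $\mathcal B_1,\mathcal B_2$ be the branches of $\mathcal G_1*\mathcal G_2$ subordinate to $\mathcal G_1$ and $\mathcal G_2$. Define rooted graphs recursively by $\mathcal G_1\vdash_1\mathcal G_2=\mathcal G_1\vdash\mathcal G_2$ and $\mathcal G_1\vdash_m\mathcal G_2=\mathcal G_1\vdash(\mathcal G_2\vdash_{m-1}\mathcal G_1)$ for $m>1$, and symmetrically $\mathcal G_2\vdash_m\mathcal G_1$. Then $(\mathcal B_1,e)$ is isomorphic, as a rooted graph, to the inductive limit $\mathcal L_1$ of the chain $\mathcal G_1\vdash_1\mathcal G_2\subset\mathcal G_1\vdash_2\mathcal G_2\subset\cdots$, and analogously $(\mathcal B_2,e)$ is isomorphic to the inductive limit $\mathcal L_2$ of the chain $\mathcal G_2\vdash_m\mathcal G_1$.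
   Context: A graph is a non-oriented connected locally finite simple graph with nonempty edge set; a rooted graph $(\mathcal G,e)=(V,E,e)$. Orthogonal product: $\mathcal G\vdash\mathcal H$ for rooted graphs $(V_{\mathcal G},E_{\mathcal G},e_{\mathcal G})$, $(V_{\mathcal H},E_{\mathcal H},e_{\mathcal H})$ has vertex set $((V_{\mathcal G}\setminus\{e_{\mathcal G}\})\times V_{\mathcal H})\cup\{(e_{\mathcal G},e_{\mathcal H})\}$, root $(e_{\mathcal G},e_{\mathcal H})$, and edges $\{(x,e_{\mathcal H}),(x',e_{\mathcal H})\}$ for $\{x,x'\}\in E_{\mathcal G}$ and $\{(x,y),(x,y')\}$ for $x\ne e_{\mathcal G}$, $\{y,y'\}\in E_{\mathcal H}$. Inclusions: $\mathcal H\hookrightarrow\mathcal H\vdash\mathcal K$ via $y\mapsto(y,e_{\mathcal K})$; a root-preserving embedding $j:\mathcal H\to\mathcal H'$ induces $\mathcal G\vdash\mathcal H\to\mathcal G\vdash\mathcal H'$, $(x,y)\mapsto(x,j(y))$. With the convention $\mathcal G_2\vdash_0\mathcal G_1=\mathcal G_2$, the inclusions $\mathcal G_1\vdash_m\mathcal G_2\to\mathcal G_1\vdash_{m+1}\mathcal G_2$ are induced recursively from the inclusions $\mathcal G_2\vdash_{m-1}\mathcal G_1\to\mathcal G_2\vdash_m\mathcal G_1$ (starting from $\mathcal G_2\hookrightarrow\mathcal G_2\vdash\mathcal G_1$), and symmetrically; the inductive limit is the union of this chain of root-preserving embeddings. Free product $\mathcal G_1*\mathcal G_2$: vertices are the empty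 word $e$ and alternating words $v_1\cdots v_m$ with letters from $V_1\setminus\{e_1\}$ and $V_2\setminus\{e_2\}$ (consecutive letters from different sets; roots identified with the empty word), edges $\{vu,v'u\}$ with $\{v,v'\}\in E_1\cup E_2$ and $u,vu,v'u$ vertices. Branch subordinate to $\mathcal G_j$: $\mathcal B_j$ is the subgraph of $\mathcal G_1*\mathcal G_2$ induced on $S_j=\{e\}\cup\{$words whose last letter lies in $V_j\setminus\{e_j\}\}$, rooted at $e$. *)

theory Defs
  imports Main
begin

record 'a rgraph =
  verts :: "'a set"
  edges :: "'a set set"
  root :: 'a

definition adj_rel :: "'a rgraph \<Rightarrow> ('a \<times> 'a) set" where
  "adj_rel G = {(x, y). {x, y} \<in> edges G}"

definition rooted_graph :: "'a rgraph \<Rightarrow> bool" where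
  "rooted_graph G \<longleftrightarrow>
     edges G \<subseteq> {{x, y} | x y. x \<in> verts G \<and> y \<in> verts G \<and> x \<noteq> y} \<and>
     edges G \<noteq> {} \<and>
     (\<forall>x \<in> verts G. finite {d \<in> edges G. x \<in> d}) \<and>
     (\<forall>x \<in> verts G. \<forall>y \<in> verts G. (x, y) \<in> (adj_rel G)\<^sup>*) \<and>
     root G \<in> verts G"

definition rooted_iso :: "'a rgraph \<Rightarrow> 'b rgraph \<Rightarrow> bool" where
  "rooted_iso G H \<longleftrightarrow>
     (\<exists>f. bij_betw f (verts G) (verts H) \<and>
          f (root G) = root H \<and>
          (\<forall>x \<in> verts G. \<forall>y \<in> verts G. {x, y} \<in> edges G \<longleftrightarrow> {f x, f y} \<in> edges H))"

definition map_rgraph :: "('a \<Rightarrow> 'b) \<Rightarrow> 'a rgraph \<Rightarrow> 'b rgraph" where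
  "map_rgraph f G = \<lparr>verts = f ` verts G, edges = (`) f ` edges G, root = f (root G)\<rparr>"

definition induced_subgraph :: "'a rgraph \<Rightarrow> 'a set \<Rightarrow> 'a rgraph" where
  "induced_subgraph G S =
     \<lparr>verts = verts G \<inter> S, edges = {d \<in> edges G. d \<subseteq> S}, root = root G\<rparr>"


section \<open>Orthogonal product and its iterates\<close>

definition orth :: "'a rgraph \<Rightarrow> 'b rgraph \<Rightarrow> ('a \<times> 'b) rgraph" where
  "orth G H =
     \<lparr>verts = (verts G - {root G}) \<times> verts H \<union> {(root G, root H)},
      edges = {{(x, root H), (x', root H)} | x x'. {x, x'} \<in> edges G} \<union>
              {{(x, y), (x, y')} | x y y'. x \<in> verts G - {root G} \<and> {y, y'} \<in> edges H},
      root = (root G, root H)\<rparr>"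

text \<open>
  The vertices of the iterated products are tuples nested to the right, whose type would depend
  on the number of iterations.  The following datatype collects all such tuples in one type:
  \<open>Node x (Node y (Leaf z))\<close> stands for \<open>(x, (y, z))\<close>.
\<close>

datatype 'v nested = Leaf 'v | Node 'v "'v nested"

text \<open>\<open>orth_iter 0 G H\<close> is \<open>G\<close>, and \<open>orth_iter 1 G H\<close> is the orthogonal product of \<open>G\<close> and \<open>H\<close>.\<close>

fun orth_iter :: "nat \<Rightarrow> 'v rgraph \<Rightarrow> 'v rgraph \<Rightarrow> 'v nested rgraph" where
  "orth_iter 0 G H = map_rgraph Leaf G"
| "orth_iter (Suc m) G H = map_rgraph (case_prod Node) (orth G (orth_iter m H G))"

text \<open>
  The inclusion of \<open>orth_iter m G H\<close> into \<open>orth_iter (Suc m) G H\<close>.  The recursion on \<open>m\<close> is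
  a recursion on the nesting depth of the vertices, so \<open>m\<close> is not needed as an argument.
\<close>

fun orth_incl :: "'v rgraph \<Rightarrow> 'v rgraph \<Rightarrow> 'v nested \<Rightarrow> 'v nested" where
  "orth_incl G H (Leaf x) = Node x (Leaf (root H))"
| "orth_incl G H (Node x y) = Node x (orth_incl H G y)"


section \<open>Inductive limit of a sequence of rooted graphs\<close>

text \<open>\<open>chain_map j m k\<close> is the composite of the \<open>k\<close> maps from stage \<open>m\<close> to stage \<open>m + k\<close>.\<close>

primrec chain_map :: "(nat \<Rightarrow> 'v \<Rightarrow> 'v) \<Rightarrow> nat \<Rightarrow> nat \<Rightarrow> 'v \<Rightarrow> 'v" where
  "chain_map j m 0 = id"
| "chain_map j m (Suc k) = j (m + k) \<circ> chain_map j m k"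

definition limit_rel ::
  "(nat \<Rightarrow> 'v rgraph) \<Rightarrow> (nat \<Rightarrow> 'v \<Rightarrow> 'v) \<Rightarrow> ((nat \<times> 'v) \<times> (nat \<times> 'v)) set" where
  "limit_rel X j =
     {((m, v), (n, w)). v \<in> verts (X m) \<and> w \<in> verts (X n) \<and>
        (\<exists>k \<ge> max m n. chain_map j m (k - m) v = chain_map j n (k - n) w)}"

definition inductive_limit ::
  "(nat \<Rightarrow> 'v rgraph) \<Rightarrow> (nat \<Rightarrow> 'v \<Rightarrow> 'v) \<Rightarrow> (nat \<times> 'v) set rgraph" where
  "inductive_limit X j =
     \<lparr>verts = (SIGMA m:UNIV. verts (X m)) // limit_rel X j,
      edges = {{limit_rel X j `` {(m, x)}, limit_rel X j `` {(m, y)}} | m x y.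
                 {x, y} \<in> edges (X m)},
      root = limit_rel X j `` {(0, root (X 0))}\<rparr>"

text \<open>Stage \<open>m\<close> of the chain is the \<open>(m + 1)\<close>-st iterate, as the chain starts with \<open>orth G H\<close>.\<close>

definition orth_limit :: "'v rgraph \<Rightarrow> 'v rgraph \<Rightarrow> (nat \<times> 'v nested) set rgraph" where
  "orth_limit G H = inductive_limit (\<lambda>m. orth_iter (Suc m) G H) (\<lambda>_. orth_incl G H)"


section \<open>Free product and branches\<close>

definition letters1 :: "'a rgraph \<Rightarrow> ('a + 'b) set" where
  "letters1 G1 = Inl ` (verts G1 - {root G1})"

definition letters2 :: "'b rgraph \<Rightarrow> ('a + 'b) set" where
  "letters2 G2 = Inr ` (verts G2 - {root G2})"

definition free_words :: "'a rgraph \<Rightarrow> 'b rgraph \<Rightarrow> ('a + 'b) list set" where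
  "free_words G1 G2 =
     {w. set w \<subseteq> letters1 G1 \<union> letters2 G2 \<and>
         (\<forall>i. Suc i < length w \<longrightarrow> isl (w ! i) \<noteq> isl (w ! Suc i))}"

text \<open>The product \<open>v u\<close> of a vertex and a word, where the root is identified with the empty word.\<close>

definition prepend1 :: "'a rgraph \<Rightarrow> 'a \<Rightarrow> ('a + 'b) list \<Rightarrow> ('a + 'b) list" where
  "prepend1 G1 v u = (if v = root G1 then u else Inl v # u)"

definition prepend2 :: "'b rgraph \<Rightarrow> 'b \<Rightarrow> ('a + 'b) list \<Rightarrow> ('a + 'b) list" where
  "prepend2 G2 v u = (if v = root G2 then u else Inr v # u)"

definition free_product :: "'a rgraph \<Rightarrow> 'b rgraph \<Rightarrow> ('a + 'b) list rgraph" where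
  "free_product G1 G2 =
     \<lparr>verts = free_words G1 G2,
      edges =
        {{prepend1 G1 v u, prepend1 G1 v' u} | v v' u. {v, v'} \<in> edges G1 \<and>
           u \<in> free_words G1 G2 \<and> prepend1 G1 v u \<in> free_words G1 G2 \<and>
           prepend1 G1 v' u \<in> free_words G1 G2} \<union>
        {{prepend2 G2 v u, prepend2 G2 v' u} | v v' u. {v, v'} \<in> edges G2 \<and>
           u \<in> free_words G1 G2 \<and> prepend2 G2 v u \<in> free_words G1 G2 \<and>
           prepend2 G2 v' u \<in> free_words G1 G2},
      root = []\<rparr>"

definition branch1 :: "'a rgraph \<Rightarrow> 'b rgraph \<Rightarrow> ('a + 'b) list rgraph" where
  "branch1 G1 G2 = induced_subgraph (free_product G1 G2)
     ({[]} \<union> {w \<in> free_words G1 G2. w \<noteq> [] \<and> last w \<in> letters1 G1})"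

definition branch2 :: "'a rgraph \<Rightarrow> 'b rgraph \<Rightarrow> ('a + 'b) list rgraph" where
  "branch2 G1 G2 = induced_subgraph (free_product G1 G2)
     ({[]} \<union> {w \<in> free_words G1 G2. w \<noteq> [] \<and> last w \<in> letters2 G2})"

end

theory Submission imports Defs begin

text \<open>
  Deleting the roots from a tuple in an iterated orthogonal product leaves an alternating word
  that starts with a letter of the first graph.  This is compatible with the inclusions, it is
  injective with image the words of bounded length, and it turns the edges of the orthogonal
  product into pairs of words that differ in the last letter.  Words of a branch are these words
  read backwards.
\<close>

section \<open>Recognising an inductive limit\<close>

lemma chain_map_in_verts:
  assumes "\<And>m v. v \<in> verts (X m) \<Longrightarrow> j m v \<in> verts (X (Suc m))"
    and "v \<in> verts (X m)"
  shows "chain_map j m k v \<in> verts (X (m + k))"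
  using assms by (induction k) auto

lemma cocone_chain_map:
  assumes "\<And>m v. v \<in> verts (X m) \<Longrightarrow> j m v \<in> verts (X (Suc m))"
    and "\<And>m v. v \<in> verts (X m) \<Longrightarrow> p (Suc m) (j m v) = p m v"
    and "v \<in> verts (X m)"
  shows "p (m + k) (chain_map j m k v) = p m v"
  using chain_map_in_verts[of X j, OF assms(1) assms(3)] assms(2) by (induction k) auto

text \<open>Compatible maps \<open>p m\<close> descend to the limit. Since each is injective, two
  representatives are equivalent exactly when they have the same image in \<open>B\<close>, so the
  classes are the fibres over \<open>B\<close>. Edges are compared after moving both endpoints to a
  common stage.\<close>

lemma rooted_iso_inductive_limit:
  fixes B :: "'b rgraph" and X :: "nat \<Rightarrow> 'v rgraph" and p :: "nat \<Rightarrow> 'v \<Rightarrow> 'b"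
  assumes incl: "\<And>m v. v \<in> verts (X m) \<Longrightarrow> j m v \<in> verts (X (Suc m))"
    and cocone: "\<And>m v. v \<in> verts (X m) \<Longrightarrow> p (Suc m) (j m v) = p m v"
    and inj: "\<And>m. inj_on (p m) (verts (X m))"
    and cover: "verts B = (\<Union>m. p m ` verts (X m))"
    and root: "p 0 (root (X 0)) = root B" "root (X 0) \<in> verts (X 0)"
    and ends: "\<And>m x y. {x, y} \<in> edges (X m) \<Longrightarrow> x \<in> verts (X m) \<and> y \<in> verts (X m)"
    and edge: "\<And>m x y. x \<in> verts (X m) \<Longrightarrow> y \<in> verts (X m) \<Longrightarrow>
                 {x, y} \<in> edges (X m) \<longleftrightarrow> {p m x, p m y} \<in> edges B"
  shows "rooted_iso B (inductive_limit X j)"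
proof -
  \<comment> \<open>The fibre of \<open>b\<close> over all stages at once; \<open>cls\<close> below
    shows that it is an equivalence class of \<open>limit_rel\<close>, so \<open>f\<close> is the
    isomorphism sought.\<close>
  define f where "f b = {(n, w). w \<in> verts (X n) \<and> p n w = b}" for b
  have lift: "\<exists>w \<in> verts (X k). p k w = p m v \<and> w = chain_map j m (k - m) v"
    if "v \<in> verts (X m)" "m \<le> k" for m k v
    using chain_map_in_verts[of X j v m "k - m", OF incl that(1)]
      cocone_chain_map[of X j p v m "k - m", OF incl cocone that(1)] that(2) by auto
  have rel: "((m, v), (n, w)) \<in> limit_rel X j \<longleftrightarrow> p m v = p n w"
    if v: "v \<in> verts (X m)" and w: "w \<in> verts (X n)" for m n v w
  proof
    assume "((m, v), (n, w)) \<in> limit_rel X j"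
    then obtain k where "k \<ge> max m n" "chain_map j m (k - m) v = chain_map j n (k - n) w"
      by (auto simp: limit_rel_def)
    then show "p m v = p n w"
      using lift[OF v, of k] lift[OF w, of k] by auto
  next
    assume eq: "p m v = p n w"
    \<comment> \<open>Pushed to the common stage \<open>max m n\<close>, both vertices keep their
      images under \<open>p\<close>, and injectivity there makes them equal.\<close>
    have "chain_map j m (max m n - m) v = chain_map j n (max m n - n) w"
      using lift[OF v, of "max m n"] lift[OF w, of "max m n"] eq inj[of "max m n"]
      by (metis inj_onD max.cobounded1 max.cobounded2)
    then show "((m, v), (n, w)) \<in> limit_rel X j"
      using v w unfolding limit_rel_def by blast
  qed
  have cls: "limit_rel X j `` {(m, v)} = f (p m v)" if "v \<in> verts (X m)" for m v
  proof (rule set_eqI)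
    fix q
    obtain n :: nat and w :: 'v where q: "q = (n, w)" by force
    have "((m, v), (n, w)) \<in> limit_rel X j \<Longrightarrow> w \<in> verts (X n)"
      by (simp add: limit_rel_def)
    then show "q \<in> limit_rel X j `` {(m, v)} \<longleftrightarrow> q \<in> f (p m v)"
      using rel[OF that, of w n] unfolding q f_def by auto
  qed
  \<comment> \<open>Every vertex of \<open>B\<close> has a nonempty fibre by \<open>cover\<close>,
    and any element of a fibre determines the vertex.\<close>
  have f_inj: "inj_on f (verts B)"
    by (rule inj_onI) (force simp: cover f_def)
  have "verts (inductive_limit X j) = f ` verts B"
    by (auto simp: inductive_limit_def quotient_def cover cls image_iff) (use cls in blast)+
  then have bij: "bij_betw f (verts B) (verts (inductive_limit X j))"
    using f_inj by (simp add: bij_betw_def)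
  have "{b, c} \<in> edges B \<longleftrightarrow> {f b, f c} \<in> edges (inductive_limit X j)"
    if b: "b \<in> verts B" and c: "c \<in> verts B" for b c
  proof
    assume e: "{b, c} \<in> edges B"
    obtain m v n w where "v \<in> verts (X m)" "p m v = b" "w \<in> verts (X n)" "p n w = c"
      using b c by (auto simp: cover)
    then obtain x y where xy: "x \<in> verts (X (max m n))" "p (max m n) x = b"
        "y \<in> verts (X (max m n))" "p (max m n) y = c"
      using lift[of v m "max m n"] lift[of w n "max m n"] by auto
    then have "{x, y} \<in> edges (X (max m n))"
      using edge e by auto
    then show "{f b, f c} \<in> edges (inductive_limit X j)"
      using xy cls unfolding inductive_limit_def by simp metis
  next
    assume "{f b, f c} \<in> edges (inductive_limit X j)"
    then obtain m x y where e: "{x, y} \<in> edges (X m)"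
      and "{f b, f c} = {limit_rel X j `` {(m, x)}, limit_rel X j `` {(m, y)}}"
      by (auto simp: inductive_limit_def)
    \<comment> \<open>Writing unordered pairs as images lets \<open>f\<close> be cancelled on whole
      sets, without distinguishing the two orientations.\<close>
    then have "f ` {b, c} = f ` {p m x, p m y}"
      using ends[OF e] cls by simp
    moreover have "{p m x, p m y} \<subseteq> verts B"
      using ends[OF e] by (auto simp: cover)
    ultimately have "{b, c} = {p m x, p m y}"
      using b c inj_on_image_eq_iff[OF f_inj, of "{b, c}" "{p m x, p m y}"] by simp
    then show "{b, c} \<in> edges B"
      using e edge ends by metis
  qed
  moreover have "f (root B) = root (inductive_limit X j)"
    using cls[OF root(2)] root(1) by (simp add: inductive_limit_def)
  ultimately show ?thesis
    using bij unfolding rooted_iso_def by blast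
qed


section \<open>Iterated orthogonal products as words\<close>

text \<open>The consequences of \<open>rooted_graph\<close> used from here on, phrased for explicit
  endpoints; they pass to copies under injective relabelling.\<close>

definition simple_rooted :: "'a rgraph \<Rightarrow> bool" where
  "simple_rooted G \<longleftrightarrow> root G \<in> verts G \<and>
     (\<forall>x y. {x, y} \<in> edges G \<longrightarrow> x \<in> verts G \<and> y \<in> verts G \<and> x \<noteq> y)"

lemma simple_rootedD:
  assumes "simple_rooted G"
  shows "root G \<in> verts G"
    and "{x, y} \<in> edges G \<Longrightarrow> x \<in> verts G"
    and "{x, y} \<in> edges G \<Longrightarrow> y \<in> verts G"
    and "{x, y} \<in> edges G \<Longrightarrow> x \<noteq> y"
  using assms unfolding simple_rooted_def by blast+

lemma rooted_graph_imp_simple_rooted: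
  assumes "rooted_graph G"
  shows "simple_rooted G"
proof -
  have "x \<in> verts G \<and> y \<in> verts G \<and> x \<noteq> y" if "{x, y} \<in> edges G" for x y
  proof -
    have "edges G \<subseteq> {{x, y} | x y. x \<in> verts G \<and> y \<in> verts G \<and> x \<noteq> y}"
      using assms by (simp add: rooted_graph_def)
    then show ?thesis using that by (force simp: doubleton_eq_iff)
  qed
  then show ?thesis using assms by (simp add: simple_rooted_def rooted_graph_def)
qed

lemma edge_map_rgraph:
  assumes "inj f"
  shows "{f x, f y} \<in> edges (map_rgraph f G) \<longleftrightarrow> {x, y} \<in> edges G"
proof -
  have "{f x, f y} = f ` d \<longleftrightarrow> {x, y} = d" for d
    using inj_image_eq_iff[OF assms, of "{x, y}" d] by simp
  then show ?thesis by (auto simp: map_rgraph_def image_iff)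
qed

lemma edge_map_rgraphE:
  assumes "inj f" "{v, w} \<in> edges (map_rgraph f G)"
  obtains x y where "v = f x" "w = f y" "{x, y} \<in> edges G"
proof -
  obtain d where d: "d \<in> edges G" "f ` d = {v, w}"
    using assms by (auto simp: map_rgraph_def)
  then obtain x y where xy: "v = f x" "w = f y" by (metis image_iff insertCI)
  then have "f ` {x, y} = f ` d" using d by simp
  then have "{x, y} = d" using assms(1) inj_image_eq_iff by metis
  then show ?thesis using that xy d by blast
qed

lemma simple_rooted_map_rgraph:
  assumes "simple_rooted G" "inj f"
  shows "simple_rooted (map_rgraph f G)"
proof -
  have "x \<in> verts (map_rgraph f G) \<and> y \<in> verts (map_rgraph f G) \<and> x \<noteq> y"
    if "{x, y} \<in> edges (map_rgraph f G)" for x y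
    using assms(2) that
    by (rule edge_map_rgraphE)
      (use assms in \<open>auto simp: map_rgraph_def inj_def dest: simple_rootedD\<close>)
  then show ?thesis
    using assms(1) by (simp add: simple_rooted_def map_rgraph_def)
qed

text \<open>Identifies the root with the empty word, so that \<open>prepend1\<close> and
  \<open>prepend2\<close> both become concatenation with a \<open>letter\<close>.\<close>

definition letter :: "'v rgraph \<Rightarrow> 'v \<Rightarrow> 'v list" where
  "letter G v = (if v = root G then [] else [v])"

lemma letter_eq_iff [simp]: "letter G v = letter G w \<longleftrightarrow> v = w"
  by (simp add: letter_def)

lemma rev_letter [simp]: "rev (letter G v) = letter G v"
  by (simp add: letter_def)

text \<open>In a vertex of an iterated product a root is followed only by roots, so stopping at the
  first root is the same as deleting all roots.\<close>

fun spell :: "'v rgraph \<Rightarrow> 'v rgraph \<Rightarrow> 'v nested \<Rightarrow> 'v list" where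
  "spell G H (Leaf x) = letter G x"
| "spell G H (Node x t) = (if x = root G then [] else x # spell H G t)"

text \<open>The two graphs trade places after each letter, exactly as in \<open>orth_iter\<close>;
  the inductions on the stage therefore keep \<open>G\<close> and \<open>H\<close>
  arbitrary.\<close>

fun alternating :: "'v rgraph \<Rightarrow> 'v rgraph \<Rightarrow> 'v list \<Rightarrow> bool" where
  "alternating G H [] \<longleftrightarrow> True"
| "alternating G H (x # xs) \<longleftrightarrow> x \<in> verts G \<and> x \<noteq> root G \<and> alternating H G xs"

text \<open>The rules mirror the two kinds of edges of \<open>orth\<close>: \<open>last\<close> is
  an edge of the first factor over the root of the second, \<open>Cons\<close> an edge inside the
  fibre over \<open>x\<close>. If an endpoint in \<open>last\<close> is a root, the words differ in
  length by one.\<close>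

inductive word_adj :: "'v rgraph \<Rightarrow> 'v rgraph \<Rightarrow> 'v list \<Rightarrow> 'v list \<Rightarrow> bool" where
  last: "{v, w} \<in> edges G \<Longrightarrow> word_adj G H (letter G v) (letter G w)"
| Cons: "x \<in> verts G \<Longrightarrow> x \<noteq> root G \<Longrightarrow> word_adj H G xs ys \<Longrightarrow> word_adj G H (x # xs) (x # ys)"

lemma word_adj_irrefl:
  "word_adj G H xs ys \<Longrightarrow> simple_rooted G \<Longrightarrow> simple_rooted H \<Longrightarrow> xs \<noteq> ys"
  by (induction rule: word_adj.induct) (auto dest: simple_rootedD(4))

section \<open>Vertices of the iterated products and their spellings\<close>

lemma in_verts_orth_iter_Suc:
  "t \<in> verts (orth_iter (Suc m) G H) \<longleftrightarrow>
     (\<exists>x s. t = Node x s \<and>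
        (x \<in> verts G \<and> x \<noteq> root G \<and> s \<in> verts (orth_iter m H G) \<or>
         x = root G \<and> s = root (orth_iter m H G)))"
  by (auto simp: map_rgraph_def orth_def image_iff)

lemma root_orth_iter_0: "root (orth_iter 0 G H) = Leaf (root G)"
  by (simp add: map_rgraph_def)

lemma root_orth_iter_Suc:
  "root (orth_iter (Suc m) G H) = Node (root G) (root (orth_iter m H G))"
  by (simp add: map_rgraph_def orth_def)

lemma root_in_verts_orth_iter:
  "root G \<in> verts G \<Longrightarrow> root H \<in> verts H \<Longrightarrow> root (orth_iter m G H) \<in> verts (orth_iter m G H)"
  by (cases m) (auto simp: map_rgraph_def orth_def)

lemma spell_root [simp]: "spell G H (root (orth_iter m G H)) = []"
  by (cases m) (simp_all only: root_orth_iter_0 root_orth_iter_Suc, simp_all add: letter_def)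

lemma orth_incl_root: "orth_incl G H (root (orth_iter m G H)) = root (orth_iter (Suc m) G H)"
  by (induction m arbitrary: G H)
    (simp_all only: root_orth_iter_0 root_orth_iter_Suc orth_incl.simps)

lemma orth_incl_in_verts:
  "t \<in> verts (orth_iter m G H) \<Longrightarrow> root H \<in> verts H \<Longrightarrow> root G \<in> verts G \<Longrightarrow>
     orth_incl G H t \<in> verts (orth_iter (Suc m) G H)"
proof (induction m arbitrary: G H t)
  case 0
  then show ?case by (auto simp: map_rgraph_def orth_def image_iff)
next
  case (Suc m)
  then obtain x s where t: "t = Node x s" and
    xs: "x \<in> verts G \<and> x \<noteq> root G \<and> s \<in> verts (orth_iter m H G) \<or>
         x = root G \<and> s = root (orth_iter m H G)"
    unfolding in_verts_orth_iter_Suc by blast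
  \<comment> \<open>If \<open>x\<close> is the root, the tail must again be the root one stage
    later; this is \<open>orth_incl_root\<close>.\<close>
  show ?case
    unfolding t in_verts_orth_iter_Suc[of _ "Suc m"]
    using xs Suc.IH[of s H G] Suc.prems orth_incl_root[of H G m] by auto
qed

text \<open>The inclusion only appends one root to the tuple, and roots leave no trace in the
  word.\<close>

lemma spell_orth_incl: "spell G H (orth_incl G H t) = spell G H t"
  by (induction t arbitrary: G H) (auto simp: letter_def)

lemma alternating_spell: "t \<in> verts (orth_iter m G H) \<Longrightarrow> alternating G H (spell G H t)"
proof (induction m arbitrary: G H t)
  case 0
  then show ?case by (auto simp: map_rgraph_def letter_def)
next
  case (Suc m)
  then show ?case unfolding in_verts_orth_iter_Suc by auto
qed

text \<open>At a fixed stage a tuple is recovered from its word by padding with roots: an empty word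
  forces the root tuple, a first letter forces the first coordinate.\<close>

lemma inj_on_spell: "inj_on (spell G H) (verts (orth_iter m G H))"
proof (induction m arbitrary: G H)
  case 0
  then show ?case by (auto simp: map_rgraph_def inj_on_def)
next
  case (Suc m)
  show ?case
    using Suc[of H G] by (auto simp: inj_on_def in_verts_orth_iter_Suc simp del: orth_iter.simps)
qed

text \<open>The bound is \<open>Suc m\<close> because the tuples of stage \<open>m\<close> have
  \<open>m + 1\<close> coordinates; shorter words are padded with roots.\<close>

lemma alternating_in_spell_image:
  assumes "alternating G H xs" "length xs \<le> Suc m" "root G \<in> verts G" "root H \<in> verts H"
  shows "xs \<in> spell G H ` verts (orth_iter m G H)"
  using assms
proof (induction m arbitrary: G H xs)
  case 0
  then consider "xs = []" | x where "xs = [x]" "x \<in> verts G" "x \<noteq> root G"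
    by (cases xs) auto
  then show ?case
    by cases (use 0 in \<open>force simp: map_rgraph_def letter_def image_iff\<close>)+
next
  case (Suc m)
  show ?case
  proof (cases xs)
    case Nil
    then show ?thesis
      using spell_root root_in_verts_orth_iter Suc.prems by (metis image_eqI)
  next
    case (Cons x ys)
    then obtain s where "s \<in> verts (orth_iter m H G)" "ys = spell H G s"
      using Suc by fastforce
    then show ?thesis
      using Cons Suc.prems(1)
      by (intro image_eqI[of _ _ "Node x s"])
        (auto simp: in_verts_orth_iter_Suc simp del: orth_iter.simps)
  qed
qed

section \<open>Edges of the iterated products\<close>

lemma edge_orth_iter_0: "{s, t} \<in> edges (orth_iter 0 G H) \<longleftrightarrow>
    (\<exists>v w. s = Leaf v \<and> t = Leaf w \<and> {v, w} \<in> edges G)"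
  by (auto simp: edge_map_rgraph inj_def elim!: edge_map_rgraphE[rotated])

lemma edge_orth_iter_Suc: "{s, t} \<in> edges (orth_iter (Suc m) G H) \<longleftrightarrow>
    (\<exists>v w x y. s = Node v x \<and> t = Node w y \<and>
       ({v, w} \<in> edges G \<and> x = root (orth_iter m H G) \<and> y = x \<or>
        v = w \<and> v \<in> verts G \<and> v \<noteq> root G \<and> {x, y} \<in> edges (orth_iter m H G)))"
proof -
  have *: "{(v, x), (w, y)} \<in> edges (orth G K) \<longleftrightarrow>
       ({v, w} \<in> edges G \<and> x = root K \<and> y = x \<or>
        v = w \<and> v \<in> verts G \<and> v \<noteq> root G \<and> {x, y} \<in> edges K)" for v x w y and K :: "'a nested rgraph"
  proof -
    have "{(v, x), (w, y)} \<in> edges (orth G K) \<longleftrightarrow>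
        (\<exists>a b. {(v, x), (w, y)} = {(a, root K), (b, root K)} \<and> {a, b} \<in> edges G) \<or>
        (\<exists>a p q. {(v, x), (w, y)} = {(a, p), (a, q)} \<and> a \<in> verts G \<and> a \<noteq> root G \<and> {p, q} \<in> edges K)"
      by (simp add: orth_def)
    \<comment> \<open>Comparing doubletons gives two orientations, which merge because the edges of
      \<open>G\<close> and \<open>K\<close> are unordered.\<close>
    then show ?thesis
      unfolding doubleton_eq_iff prod.inject by (auto simp: insert_commute) blast+
  qed
  have inj: "inj (case_prod Node)" by (auto simp: inj_def)
  show ?thesis
  proof
    assume "{s, t} \<in> edges (orth_iter (Suc m) G H)"
    then obtain a b where "s = case_prod Node a" "t = case_prod Node b"
      "{a, b} \<in> edges (orth G (orth_iter m H G))"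
      using edge_map_rgraphE[OF inj] by (metis orth_iter.simps(2))
    then show "\<exists>v w x y. s = Node v x \<and> t = Node w y \<and>
       ({v, w} \<in> edges G \<and> x = root (orth_iter m H G) \<and> y = x \<or>
        v = w \<and> v \<in> verts G \<and> v \<noteq> root G \<and> {x, y} \<in> edges (orth_iter m H G))"
      using * by (cases a; cases b) auto
  next
    assume "\<exists>v w x y. s = Node v x \<and> t = Node w y \<and>
       ({v, w} \<in> edges G \<and> x = root (orth_iter m H G) \<and> y = x \<or>
        v = w \<and> v \<in> verts G \<and> v \<noteq> root G \<and> {x, y} \<in> edges (orth_iter m H G))"
    then obtain v w x y where "s = case_prod Node (v, x)" "t = case_prod Node (w, y)"
      "{(v, x), (w, y)} \<in> edges (orth G (orth_iter m H G))"
      unfolding * by auto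
    then show "{s, t} \<in> edges (orth_iter (Suc m) G H)"
      using edge_map_rgraph[OF inj] by (metis orth_iter.simps(2))
  qed
qed

lemma edge_orth_iter_in_verts:
  "{s, t} \<in> edges (orth_iter m G H) \<Longrightarrow> simple_rooted G \<Longrightarrow> simple_rooted H \<Longrightarrow>
     s \<in> verts (orth_iter m G H) \<and> t \<in> verts (orth_iter m G H)"
proof (induction m arbitrary: G H s t)
  case 0
  then show ?case
    unfolding edge_orth_iter_0 by (auto simp: map_rgraph_def dest: simple_rootedD)
next
  case (Suc m)
  have "root (orth_iter m H G) \<in> verts (orth_iter m H G)"
    using Suc.prems simple_rootedD(1) root_in_verts_orth_iter by metis
  then show ?case
    using Suc unfolding edge_orth_iter_Suc in_verts_orth_iter_Suc
    by (auto dest: simple_rootedD)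
qed

text \<open>An edge from the first factor lies over the root of the inner product, which spells the
  empty word, hence rule \<open>last\<close>; a fibre edge gives \<open>Cons\<close> by
  induction.\<close>

lemma edge_orth_iter_imp_word_adj:
  "{s, t} \<in> edges (orth_iter m G H) \<Longrightarrow> word_adj G H (spell G H s) (spell G H t)"
proof (induction m arbitrary: G H s t)
  case 0
  then show ?case
    unfolding edge_orth_iter_0 by (auto intro: word_adj.last)
next
  case (Suc m)
  then obtain v w x y where st: "s = Node v x" "t = Node w y" and
    "{v, w} \<in> edges G \<and> x = root (orth_iter m H G) \<and> y = x \<or>
     v = w \<and> v \<in> verts G \<and> v \<noteq> root G \<and> {x, y} \<in> edges (orth_iter m H G)"
    unfolding edge_orth_iter_Suc by blast
  then consider "{v, w} \<in> edges G" "x = root (orth_iter m H G)" "y = root (orth_iter m H G)"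
    | "v = w" "v \<in> verts G" "v \<noteq> root G" "{x, y} \<in> edges (orth_iter m H G)"
    by blast
  then show ?case
  proof cases
    case 1
    then have "spell G H s = letter G v" "spell G H t = letter G w"
      by (simp_all add: st letter_def)
    then show ?thesis using 1 by (simp add: word_adj.last)
  next
    case 2
    then show ?thesis using Suc.IH by (simp add: st word_adj.Cons)
  qed
qed

text \<open>The rule behind the adjacency of the words tells which kind of edge joins the tuples. In
  case \<open>last\<close> the words have at most one letter, so both tails spell the empty word and
  are roots.\<close>

lemma word_adj_imp_edge_orth_iter:
  assumes "word_adj G H (spell G H s) (spell G H t)" "simple_rooted G" "simple_rooted H"
    and "s \<in> verts (orth_iter m G H)" "t \<in> verts (orth_iter m G H)"
  shows "{s, t} \<in> edges (orth_iter m G H)"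
  using assms
proof (induction m arbitrary: G H s t)
  case 0
  then obtain v w where st: "s = Leaf v" "t = Leaf w" by (auto simp: map_rgraph_def)
  from 0(1) show ?case
  proof cases
    case (last v' w')
    then show ?thesis using st by (simp only: edge_orth_iter_0) auto
  next
    case (Cons x xs ys)
    \<comment> \<open>A tuple of stage 0 spells at most one letter, so nothing remains after
      \<open>x\<close>; this contradicts irreflexivity.\<close>
    then have "xs = ys" using st by (auto simp: letter_def split: if_splits)
    then show ?thesis using Cons word_adj_irrefl 0 by metis
  qed
next
  case (Suc m)
  let ?r = "root (orth_iter m H G)"
  obtain v x w y where st: "s = Node v x" "t = Node w y" and
    vx: "v \<in> verts G \<and> v \<noteq> root G \<and> x \<in> verts (orth_iter m H G) \<or> v = root G \<and> x = ?r" and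
    wy: "w \<in> verts G \<and> w \<noteq> root G \<and> y \<in> verts (orth_iter m H G) \<or> w = root G \<and> y = ?r"
    using Suc.prems(4,5) unfolding in_verts_orth_iter_Suc by blast
  have "?r \<in> verts (orth_iter m H G)"
    using Suc.prems simple_rootedD(1) root_in_verts_orth_iter by metis
  \<comment> \<open>The root spells the empty word, and by injectivity it is the only vertex of its
    stage that does.\<close>
  then have nil: "z = ?r" if "spell H G z = []" "z \<in> verts (orth_iter m H G)" for z
    using inj_onD[OF inj_on_spell, of H G z ?r m] that by simp
  have "{v, w} \<in> edges G \<and> x = ?r \<and> y = x \<or>
     v = w \<and> v \<in> verts G \<and> v \<noteq> root G \<and> {x, y} \<in> edges (orth_iter m H G)"
    using Suc.prems(1)
  proof cases
    case (last v' w')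
    then have "v = v' \<and> x = ?r" "w = w' \<and> y = ?r"
      using vx wy nil by (auto simp: st letter_def split: if_splits)
    then show ?thesis using last by blast
  next
    case (Cons z xs ys)
    then show ?thesis
      using vx wy Suc.IH[of H G x y] Suc.prems by (auto simp: st split: if_splits)
  qed
  then show ?case unfolding edge_orth_iter_Suc st by blast
qed


section \<open>Branches as words\<close>

lemma alternating_append1: "alternating G H (xs @ ys) \<Longrightarrow> alternating G H xs"
  by (induction G H xs rule: alternating.induct) auto

text \<open>Unrolls the recursion into a common prefix and one edge at the end. Read backwards, the
  prefix is the common factor \<open>u\<close> in the edges of the free product.\<close>

lemma word_adjE:
  assumes "word_adj G H xs ys"
  obtains F us v w where "F \<in> {G, H}" "{v, w} \<in> edges F" "xs = us @ letter F v" "ys = us @ letter F w"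
proof -
  have "\<exists>F \<in> {G, H}. \<exists>us v w. {v, w} \<in> edges F \<and> xs = us @ letter F v \<and> ys = us @ letter F w"
    using assms
  proof induction
    case (last v w G H)
    then show ?case by (intro bexI[of _ G] exI[of _ "[]"]) auto
  next
    case (Cons x G H xs ys)
    then obtain F us v w where "F \<in> {G, H}" "{v, w} \<in> edges F"
      "x # xs = (x # us) @ letter F v" "x # ys = (x # us) @ letter F w"
      by auto
    then show ?case by blast
  qed
  then show ?thesis using that by blast
qed

text \<open>After the prefix \<open>us\<close>, alternation dictates whose turn it is; disjointness
  of the vertex sets forces \<open>F\<close> to be that graph.\<close>

lemma word_adj_appendI:
  assumes "F \<in> {G, H}" "{v, w} \<in> edges F"
    and "alternating G H (us @ letter F v)" "alternating G H (us @ letter F w)"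
    and "simple_rooted G" "simple_rooted H" "verts G \<inter> verts H = {}"
  shows "word_adj G H (us @ letter F v) (us @ letter F w)"
  using assms
proof (induction us arbitrary: G H)
  case Nil
  have "F = G"
  proof (rule ccontr)
    assume "F \<noteq> G"
    then have "F = H" using Nil by simp
    \<comment> \<open>Without loops some endpoint is not the root. It survives as a letter, which
      alternation places in \<open>G\<close> although it is a vertex of \<open>H\<close>.\<close>
    moreover have "v \<noteq> root F \<or> w \<noteq> root F"
      using Nil.prems(1,2,5,6) simple_rootedD(4)[of F v w] by auto
    ultimately have "v \<in> verts H \<and> w \<in> verts H" "v \<in> verts G \<or> w \<in> verts G"
      using Nil by (auto simp: letter_def dest: simple_rootedD split: if_splits)
    then show False using Nil by blast
  qed
  then show ?case using Nil by (auto intro: word_adj.last)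
next
  case (Cons x us)
  then show ?case by (auto intro!: word_adj.Cons)
qed

text \<open>Copies in the sum type: both graphs get the common vertex type required by
  \<open>orth_iter\<close>, with disjoint vertex sets.\<close>

abbreviation left :: "'a rgraph \<Rightarrow> ('a + 'b) rgraph" where "left \<equiv> map_rgraph Inl"
abbreviation right :: "'b rgraph \<Rightarrow> ('a + 'b) rgraph" where "right \<equiv> map_rgraph Inr"

text \<open>Both equivalences are proved together, since removing the first letter turns each into
  the other.\<close>

lemma alternating_iff_successively:
  "(alternating (left G1) (right G2) xs \<longleftrightarrow> set xs \<subseteq> letters1 G1 \<union> letters2 G2 \<and>
      successively (\<lambda>x y. isl x \<noteq> isl y) xs \<and> (xs \<noteq> [] \<longrightarrow> isl (hd xs))) \<and>
   (alternating (right G2) (left G1) xs \<longleftrightarrow> set xs \<subseteq> letters1 G1 \<union> letters2 G2 \<and>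
      successively (\<lambda>x y. isl x \<noteq> isl y) xs \<and> (xs \<noteq> [] \<longrightarrow> \<not> isl (hd xs)))"
proof (induction xs)
  case (Cons x xs)
  have "x \<in> verts (left G1) \<and> x \<noteq> root (left G1) \<longleftrightarrow> x \<in> letters1 G1 \<union> letters2 G2 \<and> isl x"
    "x \<in> verts (right G2) \<and> x \<noteq> root (right G2) \<longleftrightarrow> x \<in> letters1 G1 \<union> letters2 G2 \<and> \<not> isl x"
    by (auto simp: letters1_def letters2_def map_rgraph_def)
  then show ?case using Cons by (auto simp: successively_Cons)
qed simp

lemma in_free_words_iff:
  "w \<in> free_words G1 G2 \<longleftrightarrow> alternating (left G1) (right G2) (rev w) \<or> alternating (right G2) (left G1) (rev w)"
proof -
  have "w \<in> free_words G1 G2 \<longleftrightarrow>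
      set w \<subseteq> letters1 G1 \<union> letters2 G2 \<and> successively (\<lambda>x y. isl x \<noteq> isl y) (rev w)"
  proof -
    \<comment> \<open>Being on different sides is a symmetric relation, so alternation survives
      reversal.\<close>
    have "successively (\<lambda>x y. isl x \<noteq> isl y) (rev w) \<longleftrightarrow> successively (\<lambda>x y. isl x \<noteq> isl y) w"
      unfolding successively_rev by (rule arg_cong[where f = "\<lambda>P. successively P w"]) auto
    then show ?thesis by (simp only: free_words_def successively_conv_nth mem_Collect_eq)
  qed
  then show ?thesis using alternating_iff_successively[of G1 G2 "rev w"] by auto
qed

text \<open>The last letter of \<open>w\<close>, which decides the branch, is the first letter of
  \<open>rev w\<close>, where \<open>alternating\<close> fixes the side.\<close>

lemma verts_branch1: "w \<in> verts (branch1 G1 G2) \<longleftrightarrow> alternating (left G1) (right G2) (rev w)"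
proof -
  have "x \<in> letters1 G1 \<longleftrightarrow> isl x" if "x \<in> letters1 G1 \<union> letters2 G2" for x :: "'a + 'b"
    using that by (auto simp: letters1_def letters2_def)
  then have "last w \<in> letters1 G1 \<longleftrightarrow> isl (last w)" if "w \<noteq> []" "w \<in> free_words G1 G2"
    using that last_in_set by (fastforce simp: free_words_def)
  then show ?thesis
    using in_free_words_iff[of w G1 G2] alternating_iff_successively[of G1 G2 "rev w"]
    by (auto simp: branch1_def induced_subgraph_def free_product_def hd_rev)
qed

lemma verts_branch2: "w \<in> verts (branch2 G1 G2) \<longleftrightarrow> alternating (right G2) (left G1) (rev w)"
proof -
  have "x \<in> letters2 G2 \<longleftrightarrow> \<not> isl x" if "x \<in> letters1 G1 \<union> letters2 G2" for x :: "'a + 'b"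
    using that by (auto simp: letters1_def letters2_def)
  then have "last w \<in> letters2 G2 \<longleftrightarrow> \<not> isl (last w)" if "w \<noteq> []" "w \<in> free_words G1 G2"
    using that last_in_set by (fastforce simp: free_words_def)
  then show ?thesis
    using in_free_words_iff[of w G1 G2] alternating_iff_successively[of G1 G2 "rev w"]
    by (auto simp: branch2_def induced_subgraph_def free_product_def hd_rev)
qed

section \<open>Edges of the free product\<close>

lemma edge_free_product_iff:
  fixes G1 :: "'a rgraph" and G2 :: "'b rgraph"
  shows "{w, w'} \<in> edges (free_product G1 G2) \<longleftrightarrow>
     (\<exists>F \<in> {left G1, right G2}. \<exists>v v' u. {v, v'} \<in> edges F \<and> w = letter F v @ u \<and> w' = letter F v' @ u \<and>
        {u, w, w'} \<subseteq> free_words G1 G2)"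
proof -
  have pre: "prepend1 G1 x u = letter (left G1) (Inl x) @ u" "prepend2 G2 y u = letter (right G2) (Inr y) @ u" for x y u
    by (auto simp: prepend1_def prepend2_def letter_def map_rgraph_def)
  have E: "{Inl x, Inl x'} \<in> edges (left G1 :: ('a + 'b) rgraph) \<longleftrightarrow> {x, x'} \<in> edges G1"
    "{Inr y, Inr y'} \<in> edges (right G2 :: ('a + 'b) rgraph) \<longleftrightarrow> {y, y'} \<in> edges G2" for x x' y y'
    by (simp_all add: edge_map_rgraph)
  show ?thesis
  proof
    assume "{w, w'} \<in> edges (free_product G1 G2)"
    then obtain F v v' u where "F \<in> {left G1, right G2}" "{v, v'} \<in> edges F"
      "{w, w'} = {letter F v @ u, letter F v' @ u}" "{u, w, w'} \<subseteq> free_words G1 G2"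
    proof (simp add: free_product_def pre, elim disjE exE conjE)
      fix v v' u assume *: "{w, w'} = {letter (left G1) (Inl v) @ u, letter (left G1) (Inl v') @ u}"
        "{v, v'} \<in> edges G1" "u \<in> free_words G1 G2"
        "letter (left G1) (Inl v) @ u \<in> free_words G1 G2"
        "letter (left G1) (Inl v') @ u \<in> free_words G1 G2"
      moreover have "{u, w, w'} \<subseteq> free_words G1 G2" using * by (auto simp: doubleton_eq_iff)
      ultimately show thesis using that[of "left G1" "Inl v" "Inl v'" u] E by auto
    next
      fix v v' u assume *: "{w, w'} = {letter (right G2) (Inr v) @ u, letter (right G2) (Inr v') @ u}"
        "{v, v'} \<in> edges G2" "u \<in> free_words G1 G2"
        "letter (right G2) (Inr v) @ u \<in> free_words G1 G2"
        "letter (right G2) (Inr v') @ u \<in> free_words G1 G2"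
      moreover have "{u, w, w'} \<subseteq> free_words G1 G2" using * by (auto simp: doubleton_eq_iff)
      ultimately show thesis using that[of "right G2" "Inr v" "Inr v'" u] E by auto
    qed
    \<comment> \<open>The pair may match in the opposite order, in which case the edge is used with
      \<open>v\<close> and \<open>v'\<close> exchanged.\<close>
    moreover from this have "{v', v} \<in> edges F" by (simp add: insert_commute)
    ultimately show "\<exists>F \<in> {left G1, right G2}. \<exists>v v' u. {v, v'} \<in> edges F \<and> w = letter F v @ u \<and>
        w' = letter F v' @ u \<and> {u, w, w'} \<subseteq> free_words G1 G2"
      unfolding doubleton_eq_iff[of w] by blast
  next
    assume "\<exists>F \<in> {left G1, right G2}. \<exists>v v' u. {v, v'} \<in> edges F \<and> w = letter F v @ u \<and>
        w' = letter F v' @ u \<and> {u, w, w'} \<subseteq> free_words G1 G2"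
    then obtain F v v' u where "F \<in> {left G1, right G2}" "{v, v'} \<in> edges F"
      "w = letter F v @ u" "w' = letter F v' @ u" "{u, w, w'} \<subseteq> free_words G1 G2"
      by blast
    note F = this
    from F(1) consider "F = left G1" | "F = right G2" by blast
    then show "{w, w'} \<in> edges (free_product G1 G2)"
    proof cases
      case 1
      then obtain x x' where "v = Inl x" "v' = Inl x'" "{x, x'} \<in> edges G1"
        using F(2) by (auto elim: edge_map_rgraphE[rotated])
      then show ?thesis using F 1 unfolding free_product_def by (auto simp flip: pre)
    next
      case 2
      then obtain x x' where "v = Inr x" "v' = Inr x'" "{x, x'} \<in> edges G2"
        using F(2) by (auto elim: edge_map_rgraphE[rotated])
      then show ?thesis using F 2 unfolding free_product_def by (auto simp flip: pre)
    qed
  qed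
qed

text \<open>Reversal turns the common right factor of a free product edge into the common prefix of
  \<open>word_adj\<close>. Allowing both orders of \<open>A\<close> and \<open>B\<close> covers both
  branches.\<close>

lemma edge_free_product_iff_word_adj:
  assumes "simple_rooted G1" "simple_rooted G2"
    and "A = left G1 \<and> B = right G2 \<or> A = right G2 \<and> B = left G1"
    and "alternating A B (rev w)" "alternating A B (rev w')"
  shows "{w, w'} \<in> edges (free_product G1 G2) \<longleftrightarrow> word_adj A B (rev w) (rev w')"
proof -
  have "simple_rooted (left G1)" "simple_rooted (right G2)"
    using assms(1,2) by (simp_all add: simple_rooted_map_rgraph)
  moreover have "verts (left G1) \<inter> verts (right G2) = {}"
    by (auto simp: map_rgraph_def)
  ultimately have AB: "simple_rooted A" "simple_rooted B" "verts A \<inter> verts B = {}"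
      "{left G1, right G2} = {A, B}"
    using assms(3) by auto
  have words: "w \<in> free_words G1 G2" "w' \<in> free_words G1 G2"
    using assms(3-5) by (auto simp: in_free_words_iff)
  show ?thesis
  proof
    assume "{w, w'} \<in> edges (free_product G1 G2)"
    then obtain F v v' u where "F \<in> {A, B}" "{v, v'} \<in> edges F"
      "w = letter F v @ u" "w' = letter F v' @ u"
      unfolding edge_free_product_iff AB(4) by blast
    then show "word_adj A B (rev w) (rev w')"
      using word_adj_appendI[of F A B v v' "rev u"] AB assms by simp
  next
    assume "word_adj A B (rev w) (rev w')"
    then obtain F us v v' where F: "F \<in> {A, B}" "{v, v'} \<in> edges F"
      "rev w = us @ letter F v" "rev w' = us @ letter F v'"
      by (rule word_adjE)
    \<comment> \<open>Edges of the free product also require the common factor to be a vertex; a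
      prefix of an alternating word is alternating.\<close>
    have "alternating A B us"
      using F(3) assms(4) alternating_append1 by metis
    then have "rev us \<in> free_words G1 G2"
      using assms(3) by (auto simp: in_free_words_iff)
    moreover have "w = letter F v @ rev us" "w' = letter F v' @ rev us"
      using F(3,4) by (metis rev_append rev_letter rev_rev_ident)+
    ultimately show "{w, w'} \<in> edges (free_product G1 G2)"
      unfolding edge_free_product_iff AB(4) using F(1,2) words by blast
  qed
qed

text \<open>Combines the recognition of limits with the spelling of tuples; \<open>C\<close> stands
  for either branch, known only through its words and their adjacency.\<close>

lemma rooted_iso_orth_limit:
  fixes A B :: "'v rgraph" and C :: "'v list rgraph"
  assumes A: "simple_rooted A" and B: "simple_rooted B"
    and verts: "\<And>w. w \<in> verts C \<longleftrightarrow> alternating A B (rev w)"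
    and edges: "\<And>w w'. alternating A B (rev w) \<Longrightarrow> alternating A B (rev w') \<Longrightarrow>
       {w, w'} \<in> edges C \<longleftrightarrow> word_adj A B (rev w) (rev w')"
    and root: "root C = []"
  shows "rooted_iso C (orth_limit A B)"
  unfolding orth_limit_def
proof (rule rooted_iso_inductive_limit[where p = "\<lambda>_ t. rev (spell A B t)"])
  note roots = simple_rootedD(1)[OF A] simple_rootedD(1)[OF B]
  show "orth_incl A B v \<in> verts (orth_iter (Suc (Suc m)) A B)"
    if "v \<in> verts (orth_iter (Suc m) A B)" for m v
    using orth_incl_in_verts that roots by metis
  show "rev (spell A B (orth_incl A B v)) = rev (spell A B v)" for v
    by (simp add: spell_orth_incl)
  show "inj_on (\<lambda>t. rev (spell A B t)) (verts (orth_iter (Suc m) A B))" for m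
    using inj_on_spell[of A B "Suc m"] by (simp add: inj_on_def del: orth_iter.simps)
  \<comment> \<open>The chain begins at \<open>orth_iter 1\<close>, so its index
    \<open>length w\<close> is stage \<open>Suc (length w)\<close>, whose tuples have more than
    enough coordinates for \<open>w\<close>.\<close>
  have "w \<in> (\<lambda>t. rev (spell A B t)) ` verts (orth_iter (Suc (length w)) A B)"
    if "alternating A B (rev w)" for w
    using alternating_in_spell_image[OF that, of "Suc (length w)"] roots
    by (simp add: rev_swap image_iff del: orth_iter.simps)
  then show "verts C = (\<Union>m. (\<lambda>t. rev (spell A B t)) ` verts (orth_iter (Suc m) A B))"
    using alternating_spell unfolding set_eq_iff verts UN_iff image_iff by (metis UNIV_I rev_rev_ident)
  show "rev (spell A B (root (orth_iter (Suc 0) A B))) = root C"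
    unfolding spell_root root by simp
  show "root (orth_iter (Suc 0) A B) \<in> verts (orth_iter (Suc 0) A B)"
    using root_in_verts_orth_iter roots by metis
  show "x \<in> verts (orth_iter (Suc m) A B) \<and> y \<in> verts (orth_iter (Suc m) A B)"
    if "{x, y} \<in> edges (orth_iter (Suc m) A B)" for m x y
    using edge_orth_iter_in_verts that A B by metis
  show "{x, y} \<in> edges (orth_iter (Suc m) A B) \<longleftrightarrow>
      {rev (spell A B x), rev (spell A B y)} \<in> edges C"
    if "x \<in> verts (orth_iter (Suc m) A B)" "y \<in> verts (orth_iter (Suc m) A B)" for m x y
    using edges[of "rev (spell A B x)" "rev (spell A B y)"] alternating_spell[OF that(1)]
      alternating_spell[OF that(2)] edge_orth_iter_imp_word_adj[of x y "Suc m" A B]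
      word_adj_imp_edge_orth_iter[OF _ A B that]
    by (metis rev_rev_ident)
qed

theorem theorem7p2:
  fixes G1 :: "'a rgraph" and G2 :: "'b rgraph"
  assumes "rooted_graph G1" and "rooted_graph G2"
  shows "rooted_iso (branch1 G1 G2) (orth_limit (map_rgraph Inl G1) (map_rgraph Inr G2)) \<and>
         rooted_iso (branch2 G1 G2) (orth_limit (map_rgraph Inr G2) (map_rgraph Inl G1))"
proof -
  note simple = assms[THEN rooted_graph_imp_simple_rooted]
  note images = simple(1)[THEN simple_rooted_map_rgraph, OF inj_Inl]
    simple(2)[THEN simple_rooted_map_rgraph, OF inj_Inr]
  have edge1: "{w, w'} \<in> edges (branch1 G1 G2) \<longleftrightarrow> {w, w'} \<in> edges (free_product G1 G2)"
    if "w \<in> verts (branch1 G1 G2)" "w' \<in> verts (branch1 G1 G2)" for w w'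
    using that by (simp add: branch1_def induced_subgraph_def)
  have edge2: "{w, w'} \<in> edges (branch2 G1 G2) \<longleftrightarrow> {w, w'} \<in> edges (free_product G1 G2)"
    if "w \<in> verts (branch2 G1 G2)" "w' \<in> verts (branch2 G1 G2)" for w w'
    using that by (simp add: branch2_def induced_subgraph_def)
  have root: "root (branch1 G1 G2) = []" "root (branch2 G1 G2) = []"
    by (simp_all add: branch1_def branch2_def induced_subgraph_def free_product_def)
  \<comment> \<open>The general lemma is applied to the two copies in both orders; within a branch,
    adjacency is that of the free product.\<close>
  show ?thesis
    using edge1 edge2 edge_free_product_iff_word_adj[OF simple]
    by (intro conjI rooted_iso_orth_limit images root verts_branch1 verts_branch2)
      (simp_all add: verts_branch1 verts_branch2)
qed

end
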